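(* Let $G$ be a compactly finite-dimensional topological group, let $X\subset G$ be a subspace, and let $x\in X$ be a point at which $X$ is locally continuum-connected. Then there is a neighborhood $U\subset X$ of $x$ in $X$ whose closure in $G$ is compact.
   Context: Topological groups are assumed Hausdorff. $\dim$ denotes the covering dimension. A topological group $G$ is called compactly finite-dimensional if $\sup\{\dim(K): K \text{ is a compact subspace of } G\}$ is finite. A continuum is a connected compact Hausdorff space. Two points $x,y$ of a topological space $X$ are connected by a subcontinuum $K\subset X$ if $x,y\in K$. A topological space $X$ is locally continuum-connected at a point $x\in X$ if for every neighborhood $U\subset X$ of $x$ there is another neighborhood $V\subset U$ of $x$ such that each point $y\in V$ can be connected with $x$ by a subcontinuum $K\subset U$. *)

theory Defs
  imports "HOL-Analysis.Analysis"
begin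

definition open_cover :: "'a topology \<Rightarrow> 'a set set \<Rightarrow> bool" where
  "open_cover T \<U> \<longleftrightarrow> (\<forall>U\<in>\<U>. openin T U) \<and> \<Union>\<U> = topspace T"

text \<open>
  Every finite open cover has a finite open refinement of order at most \<open>n\<close>, i.e. no point lies
  in more than \<open>n + 1\<close> members of it. For \<open>n = -1\<close> this says that the space is empty.
\<close>
definition covering_dim_le :: "'a topology \<Rightarrow> int \<Rightarrow> bool" where
  "covering_dim_le T n \<longleftrightarrow>
     (\<forall>\<U>. finite \<U> \<and> open_cover T \<U> \<longrightarrow>
        (\<exists>\<V>. finite \<V> \<and> open_cover T \<V> \<and> (\<forall>V\<in>\<V>. \<exists>U\<in>\<U>. V \<subseteq> U) \<and>
             (\<forall>x\<in>topspace T. int (card {V\<in>\<V>. x \<in> V}) \<le> n + 1)))"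

text \<open>Values in \<open>{-1, 0, 1, \<dots>} \<union> {\<infinity>}\<close>; the infimum of the empty set is \<open>\<infinity>\<close>.\<close>
definition covering_dim :: "'a topology \<Rightarrow> ereal" where
  "covering_dim T = Inf {ereal (of_int n) | n :: int. n \<ge> -1 \<and> covering_dim_le T n}"

text \<open>The supremum is never \<open>-\<infinity>\<close>, since the empty subspace contributes \<open>-1\<close>.\<close>
definition compactly_finite_dimensional :: "'a topology \<Rightarrow> bool" where
  "compactly_finite_dimensional T \<longleftrightarrow>
     (SUP K\<in>{K. compactin T K}. covering_dim (subtopology T K)) < \<infinity>"

definition continuum :: "'a topology \<Rightarrow> bool" where
  "continuum T \<longleftrightarrow> connected_space T \<and> compact_space T \<and> Hausdorff_space T"

text \<open>Neighborhoods are not required to be open.\<close>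
definition neighborhood_in :: "'a topology \<Rightarrow> 'a \<Rightarrow> 'a set \<Rightarrow> bool" where
  "neighborhood_in T x U \<longleftrightarrow> U \<subseteq> topspace T \<and> (\<exists>W. openin T W \<and> x \<in> W \<and> W \<subseteq> U)"

definition locally_continuum_connected_at :: "'a topology \<Rightarrow> 'a \<Rightarrow> bool" where
  "locally_continuum_connected_at T x \<longleftrightarrow>
     (\<forall>U. neighborhood_in T x U \<longrightarrow>
        (\<exists>V. neighborhood_in T x V \<and> V \<subseteq> U \<and>
             (\<forall>y\<in>V. \<exists>K. K \<subseteq> U \<and> continuum (subtopology T K) \<and> x \<in> K \<and> y \<in> K)))"

end

theory Submission
  imports Defs
begin

text \<open>
  Translate \<open>x\<close> to \<open>0\<close>. If no neighbourhood of \<open>x\<close> in \<open>X\<close> is relatively compact, then small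
  continua can be chosen successively, each containing \<open>0\<close> and a point \<open>a\<^sub>i\<close> outside \<open>-P + P\<close>, where
  \<open>P\<close> is the (compact) sum of the previous ones. Keeping the later continua small enough, the addition
  map sends opposite faces of the product of \<open>n\<close> continua to disjoint subsets of the compact sum \<open>T\<close>.
  If \<open>dim T < n\<close>, there are \<open>n\<close> continuous functions on \<open>T\<close> without common zero, the \<open>i\<close>-th
  being negative on one \<open>i\<close>-th face and positive on the other. A Poincare--Miranda theorem for products of
  continua contradicts this.
\<close>

section \<open>Rational independence of the powers of a transcendental real\<close>

text \<open>An algebraic real is a root of some nonzero polynomial with integer coefficients; such
  polynomials are coded by lists of integers, and each has finitely many roots.\<close>

lemma countable_algebraic: "countable {x::real. algebraic x}"
proof (rule countable_subset)
  let ?P = "\<lambda>l. Poly (map real_of_int l)"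
  show "{x::real. algebraic x} \<subseteq> (\<Union>l\<in>{l. ?P l \<noteq> 0}. {x. poly (?P l) x = 0})"
  proof
    fix x :: real assume "x \<in> {x. algebraic x}"
    then obtain p where p: "\<And>i. coeff p i \<in> \<int>" "p \<noteq> 0" "poly p x = 0"
      by (auto simp: algebraic_def)
    have "set (coeffs p) \<subseteq> range real_of_int"
      using p(1) by (auto simp: coeffs_def Ints_def)
    then have "\<exists>l. coeffs p = map real_of_int l"
      unfolding ex_map_conv by blast
    then obtain l where "coeffs p = map real_of_int l" ..
    then have "?P l = p"
      by (metis Poly_coeffs)
    with p show "x \<in> (\<Union>l\<in>{l. ?P l \<noteq> 0}. {x. poly (?P l) x = 0})"
      by blast
  qed
  show "countable (\<Union>l\<in>{l. ?P l \<noteq> 0}. {x. poly (?P l) x = 0})"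
    by (intro countable_UN) (auto intro: countable_finite poly_roots_finite)
qed

lemma transcendental_between:
  fixes a b :: real
  assumes "a < b"
  obtains t where "a < t" "t < b" "\<not> algebraic t"
proof -
  have "\<not> {a<..<b} \<subseteq> {x. algebraic x}"
    using uncountable_open_interval[of a b] assms countable_subset[OF _ countable_algebraic] by blast
  then obtain t where "t \<in> {a<..<b}" "\<not> algebraic t" by blast
  then show thesis by (intro that[of t]) auto
qed

text \<open>The powers \<open>1, t, ..., t ^ n\<close> are \<open>n + 1\<close> vectors independent
  over the rationals, so a rational subspace spanned by \<open>card S\<close> reals can hold them
  only if \<open>n < card S\<close>. In geometric terms, \<open>(t, ..., t ^ n)\<close> lies on no
  simplex with at most \<open>n\<close> rational vertices.\<close>

lemma card_ge_if_powers_rational_combinations: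
  fixes t :: real and c :: "nat \<Rightarrow> 'v \<Rightarrow> rat" and \<mu> :: "'v \<Rightarrow> real"
  assumes t: "\<not> algebraic t" and "finite S"
    and eq: "\<And>i. i \<le> n \<Longrightarrow> t ^ i = (\<Sum>v\<in>S. of_rat (c i v) * \<mu> v)"
  shows "n < card S"
proof -
  interpret Q: vector_space "\<lambda>(q::rat) (x::real). of_rat q * x"
    by unfold_locales (auto simp: of_rat_add of_rat_mult algebra_simps)
  let ?B = "(\<lambda>i. t ^ i) ` {..n}"
  have no_root: "\<forall>i\<le>n. q i = 0" if "(\<Sum>i\<le>n. of_rat (q i) * t ^ i) = 0" for q :: "nat \<Rightarrow> rat"
  proof -
    define p where "p = (\<Sum>i\<le>n. monom (of_rat (q i) :: real) i)"
    have cp: "coeff p i = (if i \<le> n then of_rat (q i) else 0)" for i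
      by (simp add: p_def coeff_sum)
    have "poly p t = 0"
      using that by (simp add: p_def poly_sum poly_monom)
    with t have "p = 0"
      unfolding algebraic_altdef using cp by (metis Rats_0 Rats_of_rat)
    then show ?thesis
      using cp by (metis coeff_0 of_rat_eq_0_iff)
  qed
  have inj: "inj_on (\<lambda>i. t ^ i) {..n}"
  proof (rule inj_onI, rule ccontr)
    fix i j assume ij: "i \<in> {..n}" "j \<in> {..n}" "t ^ i = t ^ j" "i \<noteq> j"
    \<comment> \<open>Two equal powers would already be a rational relation, with coefficient
      \<open>1\<close> at \<open>i\<close> and \<open>-1\<close> at \<open>j\<close>.\<close>
    have "(\<Sum>k\<le>n. of_rat ((if k = i then 1 else 0) - (if k = j then 1 else 0)) * t ^ k)
        = (\<Sum>k\<le>n. (if k = i then t ^ k else 0) - (if k = j then t ^ k else 0))"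
      by (rule sum.cong) auto
    also have "\<dots> = 0"
      using ij by (simp add: sum_subtractf)
    finally show False
      using no_root[of "\<lambda>k. (if k = i then 1 else 0) - (if k = j then 1 else 0)"] ij
      by auto
  qed
  have "Q.independent ?B"
  proof
    assume "Q.dependent ?B"
    then obtain u v where v: "v \<in> ?B" "u v \<noteq> 0" "(\<Sum>v\<in>?B. of_rat (u v) * v) = 0"
      by (auto simp: Q.dependent_finite)
    then have "(\<Sum>i\<le>n. of_rat (u (t ^ i)) * t ^ i) = 0"
      by (simp add: sum.reindex[OF inj])
    from no_root[OF this] v show False by auto
  qed
  moreover have "?B \<subseteq> Q.span (\<mu> ` S)"
  proof (rule image_subsetI)
    fix i assume "i \<in> {..n}"
    then have "t ^ i = (\<Sum>v\<in>S. of_rat (c i v) * \<mu> v)" using eq by simp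
    also have "\<dots> \<in> Q.span (\<mu> ` S)"
      by (intro Q.span_sum Q.span_scale Q.span_base imageI)
    finally show "t ^ i \<in> Q.span (\<mu> ` S)" .
  qed
  ultimately have "card ?B \<le> card (\<mu> ` S)"
    using Q.independent_span_bound \<open>finite S\<close> by blast
  with card_image[OF inj] card_image_le[OF \<open>finite S\<close>, of \<mu>] show ?thesis by simp
qed

section \<open>Finite covers and sign functions from covering dimension\<close>

text \<open>A partition of unity before normalization: complete regularity gives a bump at each
  point, and compactness selects finitely many. Positivity of the sum is enough, since dividing by
  it yields barycentric coordinates.\<close>

lemma completely_regular_finite_bump_functions:
  assumes "compact_space T" "completely_regular_space T" "finite \<V>" "open_cover T \<V>"
  obtains \<phi> where "\<And>v. v \<in> \<V> \<Longrightarrow> continuous_map T euclideanreal (\<phi> v)"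
    "\<And>v z. v \<in> \<V> \<Longrightarrow> z \<in> topspace T \<Longrightarrow> 0 \<le> \<phi> v z"
    "\<And>v z. v \<in> \<V> \<Longrightarrow> z \<in> topspace T \<Longrightarrow> z \<notin> v \<Longrightarrow> \<phi> v z = 0"
    "\<And>z. z \<in> topspace T \<Longrightarrow> 0 < (\<Sum>v\<in>\<V>. \<phi> v z)"
proof -
  have "\<exists>f v. v \<in> \<V> \<and> continuous_map T euclideanreal f \<and> (\<forall>z\<in>topspace T. 0 \<le> f z)
          \<and> (\<forall>z\<in>topspace T - v. f z = 0) \<and> f y = 1" if y: "y \<in> topspace T" for y
  proof -
    obtain v where v: "v \<in> \<V>" "y \<in> v" "openin T v"
      using assms(4) y by (auto simp: open_cover_def)
    then have "closedin T (topspace T - v)" "y \<in> topspace T - (topspace T - v)"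
      using y by auto
    then obtain f where "continuous_map T (top_of_set {0..1}) f" "f y = (0::real)" "f ` (topspace T - v) \<subseteq> {1}"
      using assms(2) unfolding completely_regular_space_def by blast
    then have "v \<in> \<V> \<and> continuous_map T euclideanreal (\<lambda>z. 1 - f z) \<and> (\<forall>z\<in>topspace T. 0 \<le> 1 - f z)
          \<and> (\<forall>z\<in>topspace T - v. 1 - f z = 0) \<and> 1 - f y = 1"
      using v by (auto simp: continuous_map_in_subtopology intro!: continuous_intros)
    then show ?thesis by blast
  qed
  then have "\<forall>y\<in>topspace T. \<exists>f v. v \<in> \<V> \<and> continuous_map T euclideanreal f \<and> (\<forall>z\<in>topspace T. 0 \<le> f z)
          \<and> (\<forall>z\<in>topspace T - v. f z = 0) \<and> f y = 1" by blast
  then obtain f v where f: "\<And>y. y \<in> topspace T \<Longrightarrow> v y \<in> \<V>"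
     "\<And>y. y \<in> topspace T \<Longrightarrow> continuous_map T euclideanreal (f y)"
     "\<And>y z. y \<in> topspace T \<Longrightarrow> z \<in> topspace T \<Longrightarrow> 0 \<le> f y z"
     "\<And>y z. y \<in> topspace T \<Longrightarrow> z \<in> topspace T \<Longrightarrow> z \<notin> v y \<Longrightarrow> f y z = 0"
     "\<And>y. y \<in> topspace T \<Longrightarrow> f y y = (1::real)"
    unfolding bchoice_iff by blast
  let ?O = "\<lambda>y. {z \<in> topspace T. f y z \<in> {0<..}}"
  have "openin T (?O y)" if "y \<in> topspace T" for y
    using f(2)[OF that] by (rule openin_continuous_map_preimage) auto
  moreover have "topspace T \<subseteq> \<Union>(?O ` topspace T)"
    using f(5) by force
  ultimately obtain Y where Y: "finite Y" "Y \<subseteq> topspace T" "topspace T \<subseteq> \<Union>(?O ` Y)"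
    using assms(1) unfolding compact_space_alt by (smt (verit) finite_subset_image image_iff)
  \<comment> \<open>Several selected bumps may belong to the same cover member; they are added up,
    so that each member carries one function.\<close>
  define \<phi> where "\<phi> w z = (\<Sum>y\<in>{y\<in>Y. v y = w}. f y z)" for w z
  show thesis
  proof
    show "continuous_map T euclideanreal (\<phi> w)" for w
      unfolding \<phi>_def using f(2) Y by (intro continuous_map_sum) auto
    show "0 \<le> \<phi> w z" if "z \<in> topspace T" for w z
      unfolding \<phi>_def using f(3) Y that by (intro sum_nonneg) auto
    show "\<phi> w z = 0" if "z \<in> topspace T" "z \<notin> w" for w z
      unfolding \<phi>_def using f(4) Y that by (intro sum.neutral) auto
    show "0 < (\<Sum>w\<in>\<V>. \<phi> w z)" if z: "z \<in> topspace T" for z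
    proof -
      have "(\<Sum>w\<in>\<V>. \<phi> w z) = (\<Sum>y\<in>Y. f y z)"
        unfolding \<phi>_def using Y f(1) assms(3) by (intro sum.group) auto
      also obtain y where "y \<in> Y" "0 < f y z"
        using Y z by auto
      then have "0 < (\<Sum>y\<in>Y. f y z)"
        using Y f(3) z by (intro sum_pos2) auto
      finally show ?thesis .
    qed
  qed
qed

text \<open>
  The nerve of a cover of order at most \<open>n\<close> is sent into the union of finitely many simplices of
  dimension less than \<open>n\<close> spanned by vertices of the cube \<open>[0,1]\<^sup>n\<close>. A point whose coordinates,
  together with \<open>1\<close>, are rationally independent lies on none of these simplices; the functions
  below are the coordinates relative to such a point.
\<close>
lemma covering_dim_le_separating_functions:
  fixes A B :: "nat \<Rightarrow> 'a set"
  assumes "compact_space T" "completely_regular_space T" "covering_dim_le T (int n - 1)"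
    and closed: "\<And>i. i < n \<Longrightarrow> closedin T (A i)" "\<And>i. i < n \<Longrightarrow> closedin T (B i)"
    and disj: "\<And>i. i < n \<Longrightarrow> A i \<inter> B i = {}"
  obtains F :: "nat \<Rightarrow> 'a \<Rightarrow> real"
  where "\<And>i. i < n \<Longrightarrow> continuous_map T euclideanreal (F i)"
    "\<And>i z. i < n \<Longrightarrow> z \<in> A i \<Longrightarrow> F i z < 0" "\<And>i z. i < n \<Longrightarrow> z \<in> B i \<Longrightarrow> 0 < F i z"
    "\<And>z. z \<in> topspace T \<Longrightarrow> \<exists>i<n. F i z \<noteq> 0"
proof -
  \<comment> \<open>\<open>J\<close> records for each \<open>i\<close> which side is avoided:
    \<open>A i\<close> if \<open>i\<close> is in \<open>J\<close>, otherwise \<open>B i\<close>.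
    Hence every set refining this cover misses \<open>A i\<close> or \<open>B i\<close>, for each
    \<open>i\<close>.\<close>
  define U where "U J = topspace T - (\<Union>i\<in>J. A i) - (\<Union>i\<in>{..<n} - J. B i)" for J
  have "finite (U ` Pow {..<n})" by simp
  moreover have "open_cover T (U ` Pow {..<n})"
  proof -
    have "openin T (U J)" if "J \<subseteq> {..<n}" for J
      unfolding U_def using closed that finite_subset[OF that]
      by (intro openin_diff closedin_Union openin_topspace) auto
    moreover have "z \<in> U {i\<in>{..<n}. z \<notin> A i}" if "z \<in> topspace T" for z
      using disj that by (auto simp: U_def)
    moreover have "U J \<subseteq> topspace T" for J by (auto simp: U_def)
    ultimately show ?thesis
      unfolding open_cover_def
    proof (intro conjI subset_antisym subsetI)
      fix z assume "z \<in> topspace T"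
      with \<open>\<And>z. z \<in> topspace T \<Longrightarrow> z \<in> U _\<close> show "z \<in> \<Union>(U ` Pow {..<n})"
        by (intro UnionI[of "U {i\<in>{..<n}. z \<notin> A i}"] imageI) auto
    qed auto
  qed
  \<comment> \<open>Dimension at most \<open>n - 1\<close> means that no point lies in more than
    \<open>n\<close> members.\<close>
  ultimately obtain \<V> where \<V>: "finite \<V>" "open_cover T \<V>"
      and ref: "\<And>V. V \<in> \<V> \<Longrightarrow> \<exists>J\<subseteq>{..<n}. V \<subseteq> U J"
      and ord: "\<And>z. z \<in> topspace T \<Longrightarrow> card {V\<in>\<V>. z \<in> V} \<le> n"
    using assms(3) unfolding covering_dim_le_def by (smt (verit) imageE of_nat_le_iff PowD)
  obtain \<phi> where \<phi>: "\<And>v. v \<in> \<V> \<Longrightarrow> continuous_map T euclideanreal (\<phi> v)"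
    "\<And>v z. v \<in> \<V> \<Longrightarrow> z \<in> topspace T \<Longrightarrow> 0 \<le> \<phi> v z"
    "\<And>v z. v \<in> \<V> \<Longrightarrow> z \<in> topspace T \<Longrightarrow> z \<notin> v \<Longrightarrow> \<phi> v z = 0"
    "\<And>z. z \<in> topspace T \<Longrightarrow> 0 < (\<Sum>v\<in>\<V>. \<phi> v z)"
    using completely_regular_finite_bump_functions[OF assms(1,2) \<V>] by blast
  obtain t :: real where t: "0 < t" "t < 1" "\<not> algebraic t"
    using transcendental_between[of 0 1] by auto
  \<comment> \<open>The cube vertex assigned to \<open>v\<close>: coordinate \<open>i\<close> is
    \<open>0\<close> if \<open>v\<close> meets \<open>A i\<close>, and \<open>1\<close> otherwise,
    in particular if \<open>v\<close> meets \<open>B i\<close>.\<close>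
  define \<epsilon> :: "nat \<Rightarrow> 'a set \<Rightarrow> rat" where "\<epsilon> i v = (if v \<inter> A i = {} then 1 else 0)" for i v
  define s where "s z = (\<Sum>v\<in>\<V>. \<phi> v z)" for z
  \<comment> \<open>Coordinate \<open>i\<close> of the nerve map minus that of the point
    \<open>(t, ..., t ^ n)\<close>, multiplied by \<open>s z\<close> to avoid division. The exponent
    starts at \<open>1\<close> because \<open>t ^ 0\<close> is reserved for the relation that
    barycentric coordinates sum to \<open>1\<close>.\<close>
  define F where "F i z = (\<Sum>v\<in>\<V>. of_rat (\<epsilon> i v) * \<phi> v z) - t ^ Suc i * s z" for i z
  have inT: "A i \<subseteq> topspace T" "B i \<subseteq> topspace T" if "i < n" for i
    using closed that closedin_subset by blast+
  show thesis
  proof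
    fix i assume i: "i < n"
    show "continuous_map T euclideanreal (F i)"
      unfolding F_def s_def using \<phi>(1) by (intro continuous_intros) (use \<V> in auto)
    have pos: "0 < t ^ Suc i" "t ^ Suc i < 1"
      using t by (simp_all add: power_Suc_less_one del: power_Suc)
    show "F i z < 0" if z: "z \<in> A i" for z
    proof -
      have "z \<in> topspace T" using inT i z by blast
      have "(\<Sum>v\<in>\<V>. of_rat (\<epsilon> i v) * \<phi> v z) = 0"
        using z \<phi>(3)[OF _ \<open>z \<in> topspace T\<close>] by (intro sum.neutral) (auto simp: \<epsilon>_def)
      then show ?thesis
        using pos \<phi>(4)[OF \<open>z \<in> topspace T\<close>] by (simp add: F_def s_def)
    qed
    show "0 < F i z" if z: "z \<in> B i" for z
    proof -
      have "z \<in> topspace T" using inT i z by blast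
      have "of_rat (\<epsilon> i v) * \<phi> v z = \<phi> v z" if "v \<in> \<V>" for v
      proof (cases "z \<in> v")
        case True
        obtain J where "J \<subseteq> {..<n}" "v \<subseteq> U J" using ref \<open>v \<in> \<V>\<close> by blast
        with True z i have "i \<in> J" by (auto simp: U_def)
        with \<open>v \<subseteq> U J\<close> have "v \<inter> A i = {}" by (auto simp: U_def)
        then show ?thesis by (simp add: \<epsilon>_def)
      qed (use \<phi>(3)[OF that \<open>z \<in> topspace T\<close>] in simp)
      then have "(\<Sum>v\<in>\<V>. of_rat (\<epsilon> i v) * \<phi> v z) = s z"
        unfolding s_def by (rule sum.cong[OF refl])
      then have "F i z = (1 - t ^ Suc i) * s z"
        by (simp add: F_def algebra_simps)
      then show ?thesis
        using pos \<phi>(4)[OF \<open>z \<in> topspace T\<close>] by (simp add: s_def)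
    qed
  next
    fix z assume z: "z \<in> topspace T"
    show "\<exists>i<n. F i z \<noteq> 0"
    proof (rule ccontr)
      assume "\<not> (\<exists>i<n. F i z \<noteq> 0)"
      then have zero: "F i z = 0" if "i < n" for i using that by blast
      define S where "S = {v\<in>\<V>. z \<in> v}"
      have s: "s z > 0" using \<phi>(4)[OF z] by (simp add: s_def)
      have restr: "(\<Sum>v\<in>\<V>. r v * \<phi> v z) = (\<Sum>v\<in>S. r v * \<phi> v z)" for r
        using \<V>(1) \<phi>(3)[OF _ z] by (intro sum.mono_neutral_right) (auto simp: S_def)
      \<comment> \<open>At a common zero the barycentric coordinates of \<open>z\<close> express all
        \<open>n + 1\<close> powers rationally: exponent \<open>0\<close> by summing to
        \<open>1\<close>, exponent \<open>Suc j\<close> by \<open>F j z = 0\<close>. But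
        \<open>S\<close> has at most \<open>n\<close> elements.\<close>
      have pow: "t ^ i = (\<Sum>v\<in>S. of_rat ((case i of 0 \<Rightarrow> \<lambda>_. 1 | Suc j \<Rightarrow> \<epsilon> j) v) * (\<phi> v z / s z))" if "i \<le> n" for i
      proof (cases i)
        case 0
        then show ?thesis
          using s restr[of "\<lambda>_. 1"] by (simp add: s_def flip: sum_divide_distrib)
      next
        case (Suc j)
        then have "t ^ i * s z = (\<Sum>v\<in>S. of_rat (\<epsilon> j v) * \<phi> v z)"
          using zero[of j] that restr[of "\<lambda>v. of_rat (\<epsilon> j v)"] by (simp add: F_def)
        then show ?thesis
          using s Suc by (simp add: field_simps flip: sum_divide_distrib)
      qed
      have "finite S" using \<V>(1) by (simp add: S_def)
      from card_ge_if_powers_rational_combinations[OF t(3) this pow] have "n < card S" .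
      with ord[OF z] show False by (simp add: S_def)
    qed
  qed
qed

section \<open>Ordered sums and uniformity in topological groups\<close>

text \<open>The image of the product of \<open>K 0, ..., K (n - 1)\<close> under addition. The group
  need not be commutative, so summands are taken in index order.\<close>

definition sumset :: "(nat \<Rightarrow> 'g::monoid_add set) \<Rightarrow> nat \<Rightarrow> 'g set" where
  "sumset K n = {sum_list (map f [0..<n]) |f. \<forall>i<n. f i \<in> K i}"

lemma sumsetI: "(\<And>i. i < n \<Longrightarrow> f i \<in> K i) \<Longrightarrow> sum_list (map f [0..<n]) \<in> sumset K n"
  by (auto simp: sumset_def)

lemma sumset_Suc: "sumset K (Suc n) = (\<lambda>(x, y). x + y) ` (sumset K n \<times> K n)"
proof
  show "sumset K (Suc n) \<subseteq> (\<lambda>(x, y). x + y) ` (sumset K n \<times> K n)"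
    by (force simp: sumset_def)
  show "(\<lambda>(x, y). x + y) ` (sumset K n \<times> K n) \<subseteq> sumset K (Suc n)"
  proof clarify
    fix x y assume "x \<in> sumset K n" "y \<in> K n"
    then obtain f where f: "\<forall>i<n. f i \<in> K i" "x = sum_list (map f [0..<n])"
      by (auto simp: sumset_def)
    have "sum_list (map (f(n := y)) [0..<Suc n]) \<in> sumset K (Suc n)"
      using f \<open>y \<in> K n\<close> by (intro sumsetI) (auto simp: less_Suc_eq)
    moreover have "map (f(n := y)) [0..<n] = map f [0..<n]"
      by (rule map_cong) auto
    ultimately show "x + y \<in> sumset K (Suc n)"
      using f by simp
  qed
qed

lemma compact_plus_image:
  fixes S T :: "'g::topological_monoid_add set"
  assumes "compact S" "compact T"
  shows "compact ((\<lambda>(x, y). x + y) ` (S \<times> T))"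
  using assms by (intro compact_continuous_image compact_Times)
    (auto simp: case_prod_unfold intro!: continuous_intros)

lemma compact_sumset:
  fixes K :: "nat \<Rightarrow> 'g::topological_monoid_add set"
  shows "(\<And>i. i < n \<Longrightarrow> compact (K i)) \<Longrightarrow> compact (sumset K n)"
proof (induction n)
  case (Suc n)
  then show ?case by (simp add: sumset_Suc compact_plus_image)
qed (simp add: sumset_def)

lemma open_zero_half:
  fixes W :: "'g::topological_monoid_add set"
  assumes "open W" "0 \<in> W"
  obtains V where "open V" "0 \<in> V" "\<And>u v. u \<in> V \<Longrightarrow> v \<in> V \<Longrightarrow> u + v \<in> W"
proof -
  have "open ((\<lambda>(x, y). x + y) -` W)"
    using assms by (intro open_vimage) (auto simp: case_prod_unfold intro!: continuous_intros)
  moreover have "(0, 0) \<in> (\<lambda>(x, y). x + y) -` W"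
    using assms by simp
  ultimately obtain A B where AB: "open A" "open B" "(0, 0) \<in> A \<times> B"
      "A \<times> B \<subseteq> (\<lambda>(x, y). x + y) -` W"
    by (rule open_prod_elim)
  show thesis
    by (rule that[of "A \<inter> B"]) (use AB in auto)
qed

text \<open>Moving a small element past \<open>q\<close> conjugates it; the tube lemma keeps the
  conjugates small uniformly for \<open>q\<close> in a compact set.\<close>

lemma open_zero_conj:
  fixes W :: "'g::topological_group_add set"
  assumes "compact Q" "open W" "0 \<in> W"
  obtains V where "open V" "0 \<in> V" "\<And>v q. v \<in> V \<Longrightarrow> q \<in> Q \<Longrightarrow> - q + v + q \<in> W"
proof -
  have "open ((\<lambda>(v, q). - q + v + q) -` W)"
    using assms by (intro open_vimage) (auto simp: case_prod_unfold intro!: continuous_intros)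
  moreover have "{0} \<times> Q \<subseteq> (\<lambda>(v, q). - q + v + q) -` W"
    using assms by auto
  ultimately have "\<exists>V. 0 \<in> V \<and> open V \<and> V \<times> Q \<subseteq> (\<lambda>(v, q). - q + v + q) -` W"
    by (rule Elementary_Topology.tube_lemma[OF \<open>compact Q\<close>])
  then obtain V where "0 \<in> V" "open V" "V \<times> Q \<subseteq> (\<lambda>(v, q). - q + v + q) -` W"
    by blast
  then show thesis by (intro that[of V]) auto
qed

text \<open>By induction, since
  \<open>-(p + x) + (p' + y) = (-x + (-p + p') + x) + (-x + y)\<close>: the error of the shorter sum
  is conjugated by the last summand \<open>x\<close>, which ranges over a compact set.\<close>

lemma uniformly_continuous_sum_list:
  fixes K :: "nat \<Rightarrow> 'g::topological_group_add set"
  assumes "\<And>i. i < n \<Longrightarrow> compact (K i)" "open W" "0 \<in> W"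
  shows "\<exists>V. open V \<and> 0 \<in> V \<and> (\<forall>f g. (\<forall>i<n. f i \<in> K i \<and> - f i + g i \<in> V) \<longrightarrow>
           - sum_list (map f [0..<n]) + sum_list (map g [0..<n]) \<in> W)"
  using assms
proof (induction n arbitrary: W)
  case 0
  then show ?case by auto
next
  case (Suc n)
  obtain W1 where W1: "open W1" "0 \<in> W1" "\<And>u v. u \<in> W1 \<Longrightarrow> v \<in> W1 \<Longrightarrow> u + v \<in> W"
    using open_zero_half[OF Suc.prems(2,3)] by blast
  obtain W2 where W2: "open W2" "0 \<in> W2" "\<And>v q. v \<in> W2 \<Longrightarrow> q \<in> K n \<Longrightarrow> - q + v + q \<in> W1"
    using open_zero_conj[OF Suc.prems(1) W1(1,2), of n] by blast
  obtain V where V: "open V" "0 \<in> V" "\<And>f g. (\<forall>i<n. f i \<in> K i \<and> - f i + g i \<in> V) \<Longrightarrow>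
           - sum_list (map f [0..<n]) + sum_list (map g [0..<n]) \<in> W2"
    using Suc.IH[OF Suc.prems(1) W2(1,2)] by auto
  have "- sum_list (map f [0..<Suc n]) + sum_list (map g [0..<Suc n]) \<in> W"
    if "\<forall>i<Suc n. f i \<in> K i \<and> - f i + g i \<in> V \<inter> W1" for f g
  proof -
    let ?p = "sum_list (map f [0..<n])" and ?p' = "sum_list (map g [0..<n])"
    have "- ?p + ?p' \<in> W2" using V(3) that by simp
    then have "(- f n + (- ?p + ?p') + f n) + (- f n + g n) \<in> W"
      using W1 W2 that by blast
    then show ?thesis by (simp add: minus_add add.assoc del: add_uminus_conv_diff)
  qed
  then show ?case
    using V W1 by (intro exI[of _ "V \<inter> W1"]) (auto simp: open_Int)
qed

text \<open>The usual Lebesgue number argument with left translates. The sets \<open>V z\<close>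
  have room for two steps: one from a centre \<open>z\<close> to the given point, the other by
  \<open>w\<close>.\<close>

lemma Lebesgue_number_topological_group:
  fixes T :: "'g::topological_group_add set"
  assumes "compact T" "\<And>U. U \<in> \<O> \<Longrightarrow> open U" "T \<subseteq> \<Union>\<O>"
  obtains W where "open W" "0 \<in> W" "\<And>z. z \<in> T \<Longrightarrow> \<exists>U\<in>\<O>. \<forall>w\<in>W. z + w \<in> U"
proof -
  have "\<exists>V. open V \<and> 0 \<in> V \<and> (\<exists>U\<in>\<O>. \<forall>u\<in>V. \<forall>v\<in>V. z + (u + v) \<in> U)" if "z \<in> T" for z
  proof -
    obtain U where U: "U \<in> \<O>" "z \<in> U" using \<open>z \<in> T\<close> assms(3) by blast
    have "open ((\<lambda>w. z + w) -` U)"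
      using assms(2) U by (intro open_vimage) (auto intro!: continuous_intros)
    moreover have "0 \<in> (\<lambda>w. z + w) -` U" using U by simp
    ultimately obtain V where "open V" "0 \<in> V" "\<And>u v. u \<in> V \<Longrightarrow> v \<in> V \<Longrightarrow> u + v \<in> (\<lambda>w. z + w) -` U"
      using open_zero_half by blast
    with U show ?thesis by (intro exI[of _ V]) auto
  qed
  then obtain V where V: "\<And>z. z \<in> T \<Longrightarrow> open (V z)" "\<And>z. z \<in> T \<Longrightarrow> 0 \<in> V z"
    "\<And>z. z \<in> T \<Longrightarrow> \<exists>U\<in>\<O>. \<forall>u\<in>V z. \<forall>v\<in>V z. z + (u + v) \<in> U"
    by metis
  let ?N = "\<lambda>z. (\<lambda>y. - z + y) -` V z"
  have "open (?N z)" if "z \<in> T" for z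
    using V(1)[OF that] by (intro open_vimage) (auto intro!: continuous_intros)
  moreover have "T \<subseteq> (\<Union>z\<in>T. ?N z)" using V(2) by auto
  ultimately obtain Y where Y: "Y \<subseteq> T" "finite Y" "T \<subseteq> (\<Union>z\<in>Y. ?N z)"
    using compactE_image[OF assms(1), of T ?N] by metis
  show thesis
  proof
    show "open (\<Inter>z\<in>Y. V z)" "0 \<in> (\<Inter>z\<in>Y. V z)"
      using Y V by (auto intro!: open_INT)
    fix y assume "y \<in> T"
    then obtain z where z: "z \<in> Y" "- z + y \<in> V z" using Y by auto
    then have "z \<in> T" using Y(1) by blast
    from V(3)[OF this] obtain U where U: "U \<in> \<O>" "\<forall>u\<in>V z. \<forall>v\<in>V z. z + (u + v) \<in> U" ..
    have "y + w \<in> U" if "w \<in> (\<Inter>z\<in>Y. V z)" for w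
      using U(2)[rule_format, OF z(2), of w] that z(1) by (simp add: add.assoc)
    with U show "\<exists>U\<in>\<O>. \<forall>w\<in>\<Inter>z\<in>Y. V z. y + w \<in> U" by blast
  qed
qed

section \<open>Chains in continua and common zeros\<close>

text \<open>Points joined by finite chains of small steps form relatively open classes, so a
  connected set is one class. The chain stays at \<open>b\<close> from \<open>m\<close> on, so that
  chains in different continua can be cut to a common length.\<close>

lemma connected_chain:
  fixes K :: "'g::topological_group_add set"
  assumes "connected K" "a \<in> K" "b \<in> K" "open W" "0 \<in> W"
  obtains c :: "nat \<Rightarrow> 'g" and m where "c 0 = a" "\<And>j. j \<ge> m \<Longrightarrow> c j = b" "\<And>j. c j \<in> K"
    "\<And>j. - c j + c (Suc j) \<in> W"
proof -
  \<comment> \<open>Smallness is required in both directions to make the relation symmetric, and its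
    closure an equivalence.\<close>
  define r where "r x y \<longleftrightarrow> x \<in> K \<and> y \<in> K \<and> - x + y \<in> W \<and> - y + x \<in> W" for x y
  have sym: "symp r" by (auto simp: r_def symp_def)
  have "r\<^sup>*\<^sup>* a b"
  proof (rule connected_equivalence_relation[OF assms(1-3)])
    show "r\<^sup>*\<^sup>* y x" if "r\<^sup>*\<^sup>* x y" for x y
      using sym that by (metis symp_rtranclp sympD)
    show "\<exists>T. openin (top_of_set K) T \<and> x \<in> T \<and> (\<forall>y\<in>T. r\<^sup>*\<^sup>* x y)" if "x \<in> K" for x
    proof (intro exI conjI ballI)
      let ?T = "(\<lambda>y. - x + y) -` W \<inter> (\<lambda>y. - y + x) -` W"
      have "open ?T"
        using assms(4) by (intro open_Int open_vimage) (auto intro!: continuous_intros)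
      then show "openin (top_of_set K) (K \<inter> ?T)" by (rule openin_open_Int)
      show "x \<in> K \<inter> ?T" using that assms by auto
      show "r\<^sup>*\<^sup>* x y" if "y \<in> K \<inter> ?T" for y
        using that \<open>x \<in> K\<close> by (intro r_into_rtranclp) (auto simp: r_def)
    qed
  qed auto
  then have "\<exists>c m. c 0 = a \<and> (\<forall>j\<ge>m. c j = b) \<and> (\<forall>j::nat. c j \<in> K \<and> - c j + c (Suc j) \<in> W)"
  proof (induction rule: converse_rtranclp_induct)
    case base
    show ?case using assms by (intro exI[of _ "\<lambda>_. b"]) auto
  next
    case (step x y)
    then obtain c m where c: "c 0 = y" "\<forall>j\<ge>m. c j = b" "\<forall>j::nat. c j \<in> K \<and> - c j + c (Suc j) \<in> W"
      by blast
    have "case_nat x c 0 = x \<and> (\<forall>j\<ge>Suc m. case_nat x c j = b) \<and>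
        (\<forall>j::nat. case_nat x c j \<in> K \<and> - case_nat x c j + case_nat x c (Suc j) \<in> W)"
      using c step(1) by (auto simp: r_def split: nat.split)
    then show ?case by blast
  qed
  with that show thesis by metis
qed

text \<open>
  A Poincare--Miranda theorem for products of continua, pushed forward along the addition map:
  chains in the continua turn it into the cubical Sperner lemma on a grid.
\<close>
lemma continua_sum_common_zero:
  fixes K :: "nat \<Rightarrow> 'g::topological_group_add set" and F :: "nat \<Rightarrow> 'g \<Rightarrow> real"
  assumes K: "\<And>i. i < n \<Longrightarrow> compact (K i)" "\<And>i. i < n \<Longrightarrow> connected (K i)"
    and ab: "\<And>i. i < n \<Longrightarrow> a i \<in> K i" "\<And>i. i < n \<Longrightarrow> b i \<in> K i"
    and cont: "\<And>i. i < n \<Longrightarrow> continuous_on (sumset K n) (F i)"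
    and neg: "\<And>i z. i < n \<Longrightarrow> z \<in> sumset (K(i := {a i})) n \<Longrightarrow> F i z < 0"
    and pos: "\<And>i z. i < n \<Longrightarrow> z \<in> sumset (K(i := {b i})) n \<Longrightarrow> 0 < F i z"
  shows "\<exists>z\<in>sumset K n. \<forall>i<n. F i z = 0"
proof (rule ccontr)
  define T where "T = sumset K n"
  assume "\<not> (\<exists>z\<in>sumset K n. \<forall>i<n. F i z = 0)"
  then have nz: "\<exists>i<n. F i z \<noteq> 0" if "z \<in> T" for z
    using that by (auto simp: T_def)
  have "\<exists>P. open P \<and> P \<inter> T = F i -` {0<..} \<inter> T" "\<exists>N. open N \<and> N \<inter> T = F i -` {..<0} \<inter> T"
    if "i < n" for i
    using cont[OF that, folded T_def, unfolded continuous_on_open_invariant, rule_format, of "{0<..}"]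
      cont[OF that, folded T_def, unfolded continuous_on_open_invariant, rule_format, of "{..<0}"] by simp_all
  then obtain P N where P: "\<And>i. i < n \<Longrightarrow> open (P i)" "\<And>i. i < n \<Longrightarrow> P i \<inter> T = F i -` {0<..} \<inter> T"
    and N: "\<And>i. i < n \<Longrightarrow> open (N i)" "\<And>i. i < n \<Longrightarrow> N i \<inter> T = F i -` {..<0} \<inter> T"
    by metis
  have "T \<subseteq> \<Union>(P ` {..<n} \<union> N ` {..<n})"
  proof
    fix z assume "z \<in> T"
    with nz obtain i where "i < n" "F i z \<noteq> 0" by blast
    then have "z \<in> P i \<inter> T \<or> z \<in> N i \<inter> T"
      unfolding P(2)[OF \<open>i < n\<close>] N(2)[OF \<open>i < n\<close>] using \<open>z \<in> T\<close> by auto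
    with \<open>i < n\<close> show "z \<in> \<Union>(P ` {..<n} \<union> N ` {..<n})" by auto
  qed
  moreover have "compact T" unfolding T_def using K(1) by (rule compact_sumset)
  moreover have "open U" if "U \<in> P ` {..<n} \<union> N ` {..<n}" for U
    using that P N by auto
  \<comment> \<open>Every translate \<open>z + W\<close> with \<open>z\<close> in \<open>T\<close>
    lies in a single \<open>P i\<close> or \<open>N i\<close>, so on its part in \<open>T\<close>
    one \<open>F i\<close> has constant sign.\<close>
  ultimately obtain W where W: "open W" "0 \<in> W"
      "\<And>z. z \<in> T \<Longrightarrow> \<exists>U\<in>P ` {..<n} \<union> N ` {..<n}. \<forall>w\<in>W. z + w \<in> U"
    using Lebesgue_number_topological_group[of T "P ` {..<n} \<union> N ` {..<n}"] by metis
  obtain V where V: "open V" "0 \<in> V" "\<And>f g. (\<forall>i<n. f i \<in> K i \<and> - f i + g i \<in> V) \<Longrightarrow>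
           - sum_list (map f [0..<n]) + sum_list (map g [0..<n]) \<in> W"
    using uniformly_continuous_sum_list[of n K W, OF K(1) W(1,2)] by blast
  have "\<exists>c m. c 0 = a i \<and> (\<forall>j\<ge>m. c j = b i) \<and> (\<forall>j::nat. c j \<in> K i) \<and> (\<forall>j. - c j + c (Suc j) \<in> V)"
    if "i < n" for i
    using connected_chain[OF K(2) ab V(1,2)] that by metis
  then obtain c m where c: "\<And>i. i < n \<Longrightarrow> c i 0 = a i" "\<And>i j. i < n \<Longrightarrow> m i \<le> j \<Longrightarrow> c i j = b i"
    "\<And>i j. i < n \<Longrightarrow> c i j \<in> K i" "\<And>i j. i < n \<Longrightarrow> - c i j + c i (Suc j) \<in> V"
    by metis
  \<comment> \<open>A common grid length after which every chain has reached its endpoint;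
    \<open>Suc\<close> makes it positive, as \<open>kuhn_lemma\<close> demands.\<close>
  define p where "p = Suc (\<Sum>i<n. m i)"
  have mp: "m i \<le> p" if "i < n" for i
    using member_le_sum[of i "{..<n}" m] that by (auto simp: p_def)
  define h where "h x = sum_list (map (\<lambda>i. c i (x i)) [0..<n])" for x
  define label where "label x i = (if F i (h x) < 0 then 0 else 1 :: nat)" for x i
  have hT: "h x \<in> T" for x
    unfolding h_def T_def using c by (intro sumsetI) auto
  \<comment> \<open>The sign conditions on opposite faces are the boundary conditions of
    \<open>kuhn_lemma\<close>; it yields a small grid cube on which, for each \<open>i\<close>, both
    labels occur.\<close>
  obtain q where q: "\<forall>i<n. \<exists>r s. (\<forall>j<n. q j \<le> r j \<and> r j \<le> q j + 1) \<and> (\<forall>j<n. q j \<le> s j \<and> s j \<le> q j + 1) \<and> label r i \<noteq> label s i"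
  proof (rule kuhn_lemma[of p n label])
    show "0 < p" by (simp add: p_def)
    show "\<forall>x. (\<forall>i<n. x i \<le> p) \<longrightarrow> (\<forall>i<n. label x i = 0 \<or> label x i = 1)"
      by (simp add: label_def)
    have "h x \<in> sumset (K(i := {a i})) n" if "x i = 0" "i < n" for x i
      unfolding h_def using that c by (intro sumsetI) auto
    then show "\<forall>x. (\<forall>i<n. x i \<le> p) \<longrightarrow> (\<forall>i<n. x i = 0 \<longrightarrow> label x i = 0)"
      using neg by (simp add: label_def)
    have "h x \<in> sumset (K(i := {b i})) n" if "x i = p" "i < n" for x i
      unfolding h_def using that c mp by (intro sumsetI) auto
    then show "\<forall>x. (\<forall>i<n. x i \<le> p) \<longrightarrow> (\<forall>i<n. x i = p \<longrightarrow> label x i = 1)"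
      using pos by (fastforce simp: label_def)
  qed
  obtain U where U: "U \<in> P ` {..<n} \<union> N ` {..<n}" "\<forall>w\<in>W. h q + w \<in> U"
    using W(3)[OF hT[of q]] ..
  \<comment> \<open>The whole small cube is mapped into the one set \<open>U\<close>, on which some
    \<open>F i\<close> cannot change sign.\<close>
  have near: "h r \<in> U" if r: "\<forall>j<n. q j \<le> r j \<and> r j \<le> q j + 1" for r
  proof -
    have "- c i (q i) + c i (r i) \<in> V" if "i < n" for i
    proof -
      have "r i = q i \<or> r i = Suc (q i)" using r that by force
      then show ?thesis using c(4)[OF that] V(2) by auto
    qed
    then have "- h q + h r \<in> W"
      unfolding h_def using c(3) by (intro V(3)) auto
    from U(2)[rule_format, OF this] show ?thesis by (simp flip: add.assoc)
  qed
  obtain i where i: "i < n" "U = P i \<or> U = N i" using U by auto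
  obtain r s where "\<forall>j<n. q j \<le> r j \<and> r j \<le> q j + 1" "\<forall>j<n. q j \<le> s j \<and> s j \<le> q j + 1" "label r i \<noteq> label s i"
    using q i by blast
  moreover have "0 < F i z" if "z \<in> P i" "z \<in> T" for z
    using that P(2)[OF i(1)] by (metis IntI IntD1 greaterThan_iff vimageD)
  moreover have "F i z < 0" if "z \<in> N i" "z \<in> T" for z
    using that N(2)[OF i(1)] by (metis IntI IntD1 lessThan_iff vimageD)
  ultimately show False
    using near[of r] near[of s] hT[of r] hT[of s] i(2)
    by (smt (verit, best) label_def)
qed

section \<open>Successive choice of continua\<close>

lemma neighborhood_in_top_of_set_translate:
  fixes x :: "'g::topological_group_add"
  assumes "open W" "0 \<in> W" "x \<in> X"
  shows "neighborhood_in (top_of_set X) x {y \<in> X. - x + y \<in> W}"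
proof -
  have "open ((\<lambda>y. - x + y) -` W)"
    using assms by (intro open_vimage) (auto intro!: continuous_intros)
  then have "openin (top_of_set X) (X \<inter> (\<lambda>y. - x + y) -` W)" by (rule openin_open_Int)
  with assms show ?thesis
    unfolding neighborhood_in_def by (intro conjI exI[of _ "X \<inter> (\<lambda>y. - x + y) -` W"]) auto
qed

lemma sum_list_map_in_sumset_upd:
  "z \<in> sumset (K(i := {a})) n \<Longrightarrow> i < n \<Longrightarrow> a \<in> K i \<Longrightarrow>
    \<exists>f. z = sum_list (map f [0..<n]) \<and> f i = a \<and> (\<forall>j<n. f j \<in> K j)"
  unfolding sumset_def by clarify (metis fun_upd_apply singletonD)

text \<open>
  Opposite faces \<open>f i = 0\<close> and \<open>f i = a i\<close> of the product of the continua have disjoint images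
  under addition. The neighbourhood \<open>W\<close> is the room left for the continua still to be chosen.
\<close>
lemma continua_with_disjoint_faces:
  fixes X :: "'g::{topological_group_add, t2_space} set"
  assumes "x \<in> X" and lcc: "locally_continuum_connected_at (top_of_set X) x"
    and noncompact: "\<nexists>U. neighborhood_in (top_of_set X) x U \<and> compact (closure U)"
  shows "\<exists>(K :: nat \<Rightarrow> 'g set) a W. open W \<and> 0 \<in> W
    \<and> (\<forall>i<n. compact (K i) \<and> connected (K i) \<and> 0 \<in> K i \<and> a i \<in> K i)
    \<and> (\<forall>i<n. \<forall>f g. \<forall>w\<in>W. \<forall>w'\<in>W. (\<forall>j<n. f j \<in> K j \<and> g j \<in> K j) \<and> f i = 0 \<and> g i = a i \<longrightarrow>
          sum_list (map f [0..<n]) + w \<noteq> sum_list (map g [0..<n]) + w')"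
proof (induction n)
  case 0
  show ?case by (auto intro: exI[of _ UNIV])
next
  case (Suc n)
  then obtain K a and W :: "'g set" where W: "open W" "0 \<in> W"
    and K: "\<forall>i<n. compact (K i) \<and> connected (K i) \<and> 0 \<in> K i \<and> a i \<in> K i"
    and disj: "\<forall>i<n. \<forall>f g. \<forall>w\<in>W. \<forall>w'\<in>W. (\<forall>j<n. f j \<in> K j \<and> g j \<in> K j) \<and> f i = 0 \<and> g i = a i \<longrightarrow>
          sum_list (map f [0..<n]) + w \<noteq> sum_list (map g [0..<n]) + w'"
    by (elim exE conjE) (rule that, assumption+)
  \<comment> \<open>The old room \<open>W\<close> is halved: one half for the new continuum, the
    other for those still to come.\<close>
  obtain W1 where W1: "open W1" "0 \<in> W1" "\<And>u v. u \<in> W1 \<Longrightarrow> v \<in> W1 \<Longrightarrow> u + v \<in> W"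
    using open_zero_half[OF W] by blast
  obtain V where V: "neighborhood_in (top_of_set X) x V"
     "\<And>y. y \<in> V \<Longrightarrow> \<exists>L. L \<subseteq> {y \<in> X. - x + y \<in> W1} \<and> continuum (subtopology (top_of_set X) L) \<and> x \<in> L \<and> y \<in> L"
    using lcc neighborhood_in_top_of_set_translate[OF W1(1,2) \<open>x \<in> X\<close>]
    unfolding locally_continuum_connected_at_def by meson
  \<comment> \<open>Differences of old sums. A new endpoint outside \<open>D\<close> separates the
    two new faces, and it exists because \<open>V\<close> does not fit into the compact set
    \<open>x + D\<close>.\<close>
  define D where "D = (\<lambda>(p, q). - p + q) ` (sumset K n \<times> sumset K n)"
  have "compact (sumset K n)" using K compact_sumset by blast
  then have "compact D"
    unfolding D_def by (intro compact_continuous_image compact_Times)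
      (auto simp: case_prod_unfold intro!: continuous_intros)
  have "\<not> V \<subseteq> (\<lambda>d. x + d) ` D"
  proof
    assume sub: "V \<subseteq> (\<lambda>d. x + d) ` D"
    have "compact ((\<lambda>d. x + d) ` D)"
      using \<open>compact D\<close> by (intro compact_continuous_image) (auto intro!: continuous_intros)
    moreover from this sub have "closure V \<subseteq> (\<lambda>d. x + d) ` D"
      by (intro closure_minimal compact_imp_closed)
    ultimately have "compact (closure V)"
      by (metis closed_closure compact_Int_closed inf.absorb2)
    with noncompact V(1) show False by blast
  qed
  then obtain y where y: "y \<in> V" "y \<notin> (\<lambda>d. x + d) ` D" by blast
  define b where "b = - x + y"
  have b: "b \<notin> D"
  proof
    assume "b \<in> D"
    then have "x + b \<in> (\<lambda>d. x + d) ` D" by blast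
    with y show False by (simp add: b_def flip: add.assoc)
  qed
  obtain L where L: "L \<subseteq> {y \<in> X. - x + y \<in> W1}" "continuum (subtopology (top_of_set X) L)" "x \<in> L" "y \<in> L"
    using V(2) y by blast
  have "subtopology (top_of_set X) L = top_of_set L"
    using L(1) by (simp add: subtopology_subtopology Int_absorb1 subset_iff)
  with L(2) have "compact L" "connected L"
    by (auto simp: continuum_def compact_space_def simp flip: connectedin_iff_connected connectedin_topspace
        intro!: connectedin_subtopology[THEN iffD1, THEN conjunct1])
  define M where "M = (\<lambda>y. - x + y) ` L"
  have M: "compact M" "connected M" "0 \<in> M" "b \<in> M" "M \<subseteq> W1"
    unfolding M_def b_def using \<open>compact L\<close> \<open>connected L\<close> L
    by (auto intro!: compact_continuous_image connected_continuous_image continuous_intros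
        intro: image_eqI[of _ _ x])
  \<comment> \<open>\<open>D\<close> is closed, so \<open>b\<close> stays outside it after
    perturbation by small \<open>w'\<close> and \<open>w\<close>; this fixes the new room
    \<open>W2\<close>.\<close>
  have "open ((\<lambda>(w', w). b + (w' - w)) -` (- D))"
    using \<open>compact D\<close> by (intro open_vimage)
      (auto simp: case_prod_unfold compact_imp_closed open_Compl intro!: continuous_intros)
  moreover have "(0, 0) \<in> (\<lambda>(w', w). b + (w' - w)) -` (- D)"
    using b by simp
  ultimately obtain A B where AB: "open A" "open B" "(0, 0) \<in> A \<times> B"
      "A \<times> B \<subseteq> (\<lambda>(w', w). b + (w' - w)) -` (- D)"
    by (rule open_prod_elim)
  define W2 where "W2 = W1 \<inter> A \<inter> B"
  have W2: "open W2" "0 \<in> W2" using W1 AB by (auto simp: W2_def)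
  have faces: "sum_list (map f [0..<Suc n]) + w \<noteq> sum_list (map g [0..<Suc n]) + w'"
    if i: "i < Suc n" and w: "w \<in> W2" "w' \<in> W2"
      and fg: "\<forall>j<Suc n. f j \<in> (K(n := M)) j \<and> g j \<in> (K(n := M)) j" "f i = 0" "g i = (a(n := b)) i"
    for i f g w w'
  proof (cases "i = n")
    case False
    \<comment> \<open>For an old pair of faces, the last summand together with \<open>w\<close> is a
      perturbation allowed by the induction hypothesis.\<close>
    have "f n + w \<in> W" "g n + w' \<in> W"
      using fg(1)[rule_format, of n] w M(5) W1(3) by (auto simp: W2_def)
    moreover have "\<forall>j<n. f j \<in> K j \<and> g j \<in> K j"
    proof (intro allI impI)
      fix j assume "j < n" then show "f j \<in> K j \<and> g j \<in> K j" using fg(1)[rule_format, of j] by auto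
    qed
    ultimately show ?thesis
      using disj[rule_format, of i "f n + w" "g n + w'" f g] i fg False by (simp add: add.assoc)
  next
    case True
    let ?p = "sum_list (map f [0..<n])" and ?q = "sum_list (map g [0..<n])"
    have fgj: "f j \<in> K j \<and> g j \<in> K j" if "j < n" for j using fg(1)[rule_format, of j] that by auto
    show ?thesis
    proof
      assume "sum_list (map f [0..<Suc n]) + w = sum_list (map g [0..<Suc n]) + w'"
      \<comment> \<open>Here \<open>f n = 0\<close> and \<open>g n = b\<close>, so a coincidence
        would put a perturbation of \<open>b\<close> into \<open>D\<close>.\<close>
      then have "?p + w = ?q + b + w'"
        using fg(2,3) True by simp
      then have "?p = ?q + b + w' - w" by (simp add: eq_diff_eq)
      then have "- ?q + ?p = b + (w' - w)"
        by (simp add: add.assoc add_diff_eq)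
      moreover have "- ?q + ?p \<in> D"
        unfolding D_def using fgj by (force intro!: sumsetI)
      ultimately show False using AB w by (auto simp: W2_def)
    qed
  qed
  have "\<forall>i<Suc n. compact ((K(n := M)) i) \<and> connected ((K(n := M)) i) \<and> 0 \<in> (K(n := M)) i
      \<and> (a(n := b)) i \<in> (K(n := M)) i"
    using K M by (auto simp: less_Suc_eq)
  moreover have "\<forall>i<Suc n. \<forall>f g. \<forall>w\<in>W2. \<forall>w'\<in>W2.
      (\<forall>j<Suc n. f j \<in> (K(n := M)) j \<and> g j \<in> (K(n := M)) j) \<and> f i = 0 \<and> g i = (a(n := b)) i \<longrightarrow>
      sum_list (map f [0..<Suc n]) + w \<noteq> sum_list (map g [0..<Suc n]) + w'"
    by (intro allI ballI impI, elim conjE) (rule faces)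
  ultimately show ?case
    using W2 by (intro exI[of _ "K(n := M)"] exI[of _ "a(n := b)"] exI[of _ W2] conjI)
qed

section \<open>Uniform dimension bound and conclusion\<close>

lemma covering_dim_le_mono:
  assumes "covering_dim_le T m" "m \<le> n"
  shows "covering_dim_le T n"
  unfolding covering_dim_le_def
proof (intro allI impI)
  fix \<U> assume "finite \<U> \<and> open_cover T \<U>"
  then obtain \<V> where "finite \<V>" "open_cover T \<V>" "\<forall>V\<in>\<V>. \<exists>U\<in>\<U>. V \<subseteq> U"
      "\<forall>x\<in>topspace T. int (card {V\<in>\<V>. x \<in> V}) \<le> m + 1"
    using assms(1) unfolding covering_dim_le_def by meson
  moreover from this(4) have "\<forall>x\<in>topspace T. int (card {V\<in>\<V>. x \<in> V}) \<le> n + 1"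
    using assms(2) by force
  ultimately show "\<exists>\<V>. finite \<V> \<and> open_cover T \<V> \<and> (\<forall>V\<in>\<V>. \<exists>U\<in>\<U>. V \<subseteq> U) \<and>
      (\<forall>x\<in>topspace T. int (card {V\<in>\<V>. x \<in> V}) \<le> n + 1)"
    by (intro exI[of _ \<V>] conjI)
qed

lemma compactly_finite_dimensional_bound:
  assumes "compactly_finite_dimensional T"
  obtains N :: nat where "\<And>K. compactin T K \<Longrightarrow> covering_dim_le (subtopology T K) (int N - 1)"
proof -
  let ?S = "SUP K\<in>{K. compactin T K}. covering_dim (subtopology T K)"
  obtain N :: nat where N: "?S < ereal (real N)"
    using assms unfolding compactly_finite_dimensional_def
    using less_PInf_Ex_of_nat[of ?S] by auto
  have "covering_dim_le (subtopology T K) (int N - 1)" if "compactin T K" for K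
  proof -
    have "covering_dim (subtopology T K) < ereal (real N)"
      using N that by (meson SUP_upper le_less_trans mem_Collect_eq)
    \<comment> \<open>The strict bound on the infimum provides an actual integer \<open>m\<close>
      below \<open>N\<close>, hence at most \<open>N - 1\<close>.\<close>
    then obtain m :: int where "covering_dim_le (subtopology T K) m" "ereal (of_int m) < ereal (real N)"
      unfolding covering_dim_def Inf_less_iff by blast
    then have "m \<le> int N - 1" by simp
    with \<open>covering_dim_le (subtopology T K) m\<close> show ?thesis
      by (rule covering_dim_le_mono)
  qed
  with that show thesis by blast
qed

theorem lemma1p1:
  fixes X :: "'g :: {topological_group_add, t2_space} set" and x :: 'g
  assumes "compactly_finite_dimensional (euclidean :: 'g topology)"
    and "x \<in> X"
    and "locally_continuum_connected_at (top_of_set X) x"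
  shows "\<exists>U. neighborhood_in (top_of_set X) x U \<and> compact (closure U)"
proof (rule ccontr)
  assume noncompact: "\<nexists>U. neighborhood_in (top_of_set X) x U \<and> compact (closure U)"
  \<comment> \<open>The number of continua is fixed only now: one more than a dimension bound valid
    for all compact subsets, hence for their sum.\<close>
  obtain n where dim: "\<And>T :: 'g set. compact T \<Longrightarrow> covering_dim_le (top_of_set T) (int n - 1)"
    using compactly_finite_dimensional_bound[OF assms(1)] by (metis compactin_euclidean_iff)
  obtain K a and W :: "'g set" where W: "0 \<in> W"
    and K_all: "\<forall>i<n. compact (K i) \<and> connected (K i) \<and> 0 \<in> K i \<and> a i \<in> K i"
    and disj: "\<forall>i<n. \<forall>f g. \<forall>w\<in>W. \<forall>w'\<in>W. (\<forall>j<n. f j \<in> K j \<and> g j \<in> K j) \<and> f i = 0 \<and> g i = a i \<longrightarrow>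
          sum_list (map f [0..<n]) + w \<noteq> sum_list (map g [0..<n]) + w'"
    using continua_with_disjoint_faces[OF assms(2,3) noncompact, of n] by (elim exE conjE) (rule that, assumption+)
  have K: "\<And>i. i < n \<Longrightarrow> compact (K i)" "\<And>i. i < n \<Longrightarrow> connected (K i)"
      "\<And>i. i < n \<Longrightarrow> 0 \<in> K i" "\<And>i. i < n \<Longrightarrow> a i \<in> K i"
    using K_all by blast+
  define T where "T = sumset K n"
  define A B where "A i = sumset (K(i := {0})) n" and "B i = sumset (K(i := {a i})) n" for i
  have "compact T" unfolding T_def using K(1) by (rule compact_sumset)
  have face: "closedin (top_of_set T) (sumset (K(i := {u})) n)" if "i < n" "u \<in> K i" for i u
  proof (rule closed_subset)
    show "sumset (K(i := {u})) n \<subseteq> T"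
    proof
      fix z assume "z \<in> sumset (K(i := {u})) n"
      from sum_list_map_in_sumset_upd[OF this that] show "z \<in> T"
        unfolding T_def by (metis sumsetI)
    qed
    show "closed (sumset (K(i := {u})) n)"
      using K by (intro compact_imp_closed compact_sumset) auto
  qed
  have "A i \<inter> B i = {}" if i: "i < n" for i
  proof -
    \<comment> \<open>Disjointness of the faces is the case of zero perturbations,
      \<open>w = w' = 0\<close>.\<close>
    have False if "z \<in> A i" "z \<in> B i" for z
      using sum_list_map_in_sumset_upd[OF that(1)[unfolded A_def] i K(3)[OF i]]
        sum_list_map_in_sumset_upd[OF that(2)[unfolded B_def] i K(4)[OF i]] disj[rule_format, OF i W W] by metis
    then show ?thesis by blast
  qed
  moreover have "Hausdorff_space (euclidean :: 'g topology)"
    unfolding Hausdorff_space_def disjnt_def using hausdorff by auto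
  moreover have "compact_space (top_of_set T)"
    using \<open>compact T\<close> by (simp add: compact_space_subtopology)
  moreover from calculation(2,3) have "completely_regular_space (top_of_set T)"
    by (intro normal_imp_completely_regular_space compact_Hausdorff_or_regular_imp_normal_space)
      (auto simp: Hausdorff_space_subtopology)
  ultimately obtain F :: "nat \<Rightarrow> 'g \<Rightarrow> real"
    where F: "\<And>i. i < n \<Longrightarrow> continuous_map (top_of_set T) euclideanreal (F i)"
    "\<And>i z. i < n \<Longrightarrow> z \<in> A i \<Longrightarrow> F i z < 0" "\<And>i z. i < n \<Longrightarrow> z \<in> B i \<Longrightarrow> 0 < F i z"
    "\<And>z. z \<in> topspace (top_of_set T) \<Longrightarrow> \<exists>i<n. F i z \<noteq> 0"
    using covering_dim_le_separating_functions[OF _ _ dim[OF \<open>compact T\<close>], of A B] face K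
    unfolding A_def B_def by blast
  \<comment> \<open>The endpoints in the \<open>i\<close>-th continuum are \<open>0\<close> and
    \<open>a i\<close>, matching the faces \<open>A i\<close> and \<open>B i\<close>.\<close>
  have "\<exists>z\<in>sumset K n. \<forall>i<n. F i z = 0"
    by (rule continua_sum_common_zero[of n K "\<lambda>_. 0" a])
      (use K F in \<open>auto simp: A_def B_def T_def\<close>)
  with F(4) show False by (auto simp: T_def)
qed

end
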